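(* Let $p = p_1p_2\ldots p_m$ and $w = w_1w_2\ldots w_n$ be binary words. Write $p = A_1A_2\ldots A_r$ as the concatenation of its $r$ runs and $w = B_1B_2\ldots B_s$ as the concatenation of its $s$ runs. If the lexicographically minimal occurrence $\mathrm{L}_p(w)$ of $p$ in $w$ exists, then the number $c_p(w)$ of occurrences of $p$ in $w$ is $$c_p(w) = \sum_{q_1=|A_r|}^{\sigma(w;\mathrm{L}_p^r(w),\zeta_p^w)}\binom{q_1-1}{|A_r|-1}\sum_{q_2=|A_{r-1}|}^{\sigma(w;\mathrm{L}_p^{r-1}(w),t(q_1))}\binom{q_2-1}{|A_{r-1}|-1}\cdots\sum_{q_r=|A_1|}^{\sigma(w;\mathrm{L}_p^{1}(w),t(q_{r-1}))}\binom{q_r-1}{|A_1|-1},$$ where $t(q_1) = \zeta_p^w - 2\lambda(w;\zeta_p^w;q_1) - 1$ and $t(q_{k+1}) = t(q_k) - 2\lambda(w;t(q_k);q_{k+1}) - 1$.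
   Context: A run of a binary word is a maximal block of consecutive identical letters; its parity is even if it consists of 0's and odd if it consists of 1's. A subword of $w$ is obtained by deleting letters and is identified with its tuple of indices in $w$; an occurrence of $p$ in $w$ is a subword of $w$ equal to $p$, and $c_p(w)$ is the number of such occurrences. For runs $B_i, B_j$ of $w$ of the same parity, $\sigma(w;i,j) := \sum_{k=0}^{(j-i)/2}|B_{i+2k}|$ (with the usual convention that empty sums are 0). The same-parity left-span is $\lambda(w;i;j) := \min\{k \mid \sigma(w;i-2k,i) \ge j\}$. Define $\zeta_p^w := s$ if $A_r$ and $B_s$ have the same parity and $\zeta_p^w := s-1$ otherwise. The lexicographically minimal occurrence $\mathrm{L}_p(w)$ is an occurrence of $p$ in $w$ such that for every occurrence $p'$ of $p$ in $w$ and every $j\in[m]$, the $j$th letter of $p'$ is not to the left (in $w$) of the $j$th letter of $\mathrm{L}_p(w)$. Write $\mathrm{L}_p(w) = L_1\ldots L_r$ with $L_i$ the part corresponding to $A_i$; the $i$th head $\mathrm{L}_p^i(w)$ is the index of the run of $w$ containing the first letter of $L_i$. *)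

theory Defs
  imports Complex_Main
begin

text \<open>
  Binary words are \<^typ>\<open>bool list\<close>s, with \<^term>\<open>False\<close> for the letter 0 and \<^term>\<open>True\<close> for 1.
  Positions of letters are 0-based list indices; runs are numbered from 1, and run indices
  are integers, so that differences of indices are not truncated.
\<close>

function runs :: "'a list \<Rightarrow> 'a list list" where
  "runs [] = []"
| "runs (x # xs) = (x # takeWhile (\<lambda>y. y = x) xs) # runs (dropWhile (\<lambda>y. y = x) xs)"
  by pat_completeness auto
termination
  by (relation "measure length") (auto simp: length_dropWhile_le less_Suc_eq_le)

lemma concat_runs: "concat (runs w) = w"
  by (induction w rule: runs.induct) auto

lemma runs_constant: "B \<in> set (runs w) \<Longrightarrow> B \<noteq> [] \<and> set B = {hd B}"
  by (induction w rule: runs.induct) (auto dest: set_takeWhileD)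

lemma runs_maximal: "Suc i < length (runs w) \<Longrightarrow> hd (runs w ! i) \<noteq> hd (runs w ! Suc i)"
proof (induction w arbitrary: i rule: runs.induct)
  case (2 x xs)
  show ?case
  proof (cases i)
    case 0
    then show ?thesis
      using 2(2) hd_dropWhile[of "\<lambda>y. y = x" xs]
      by (cases "dropWhile (\<lambda>y. y = x) xs") auto
  qed (use 2 in auto)
qed simp

definition num_runs :: "'a list \<Rightarrow> nat" where
  "num_runs w = length (runs w)"

text \<open>Runs with an index outside \<open>1, \<dots>, s\<close> do not exist and are given length 0.\<close>

definition run_len :: "'a list \<Rightarrow> int \<Rightarrow> nat" where
  "run_len w i = (if 1 \<le> i \<and> i \<le> int (num_runs w) then length (runs w ! nat (i - 1)) else 0)"

text \<open>A run is even if it consists of 0's and odd if it consists of 1's; so its head determines its parity.\<close>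

definition same_parity :: "bool list \<Rightarrow> bool list \<Rightarrow> bool" where
  "same_parity A B \<longleftrightarrow> hd A = hd B"

definition occurrences :: "'a list \<Rightarrow> 'a list \<Rightarrow> nat list set" where
  "occurrences p w =
     {I. sorted_wrt (<) I \<and> set I \<subseteq> {..<length w} \<and> map (\<lambda>i. w ! i) I = p}"

definition occ_count :: "'a list \<Rightarrow> 'a list \<Rightarrow> nat" where
  "occ_count p w = card (occurrences p w)"

definition lexmin_occurrence :: "'a list \<Rightarrow> 'a list \<Rightarrow> nat list \<Rightarrow> bool" where
  "lexmin_occurrence p w L \<longleftrightarrow>
     L \<in> occurrences p w \<and> (\<forall>I \<in> occurrences p w. \<forall>j < length p. L ! j \<le> I ! j)"

text \<open>
  The number of the run containing position \<open>x\<close>: the first \<open>i\<close> such that the first \<open>i\<close> runs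
  together have more than \<open>x\<close> letters.
\<close>

definition run_index :: "'a list \<Rightarrow> nat \<Rightarrow> nat" where
  "run_index w x = (LEAST i. x < length (concat (take i (runs w))))"

text \<open>
  If \<open>L\<close> is an occurrence of \<open>p\<close>, the part of \<open>L\<close> corresponding to the \<open>i\<close>-th run of \<open>p\<close> starts
  right after the letters of the first \<open>i - 1\<close> runs (\<open>i \<ge> 1\<close>).
\<close>

definition occ_head :: "'a list \<Rightarrow> 'a list \<Rightarrow> nat list \<Rightarrow> nat \<Rightarrow> int" where
  "occ_head p w L i = int (run_index w (L ! length (concat (take (i - 1) (runs p)))))"

text \<open>Only meaningful if \<open>i\<close> and \<open>j\<close> have the same parity; the sum is empty for \<open>j < i\<close>.\<close>

definition run_sigma :: "'a list \<Rightarrow> int \<Rightarrow> int \<Rightarrow> nat" where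
  "run_sigma w i j = (\<Sum>k = 0..(j - i) div 2. run_len w (i + 2 * k))"

definition left_span :: "'a list \<Rightarrow> int \<Rightarrow> nat \<Rightarrow> nat" where
  "left_span w i j = (LEAST k. run_sigma w (i - 2 * int k) i \<ge> j)"

definition zeta :: "bool list \<Rightarrow> bool list \<Rightarrow> int" where
  "zeta p w =
     (if same_parity (last (runs p)) (last (runs w)) then int (num_runs w)
      else int (num_runs w) - 1)"

text \<open>
  \<open>nested_sum p w L k t\<close> consists of the innermost \<open>k\<close> summations, which belong to the runs
  \<open>k, \<dots>, 1\<close> of \<open>p\<close>; \<open>t\<close> is the index of the last run of \<open>w\<close> available to run \<open>k\<close> of \<open>p\<close>.
  For the outermost sum \<open>t\<close> is \<open>zeta p w\<close>; every further sum uses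
  \<open>t - 2 * left_span w t q - 1\<close>, with \<open>t\<close> and \<open>q\<close> those of the sum around it.
\<close>

fun nested_sum :: "'a list \<Rightarrow> 'a list \<Rightarrow> nat list \<Rightarrow> nat \<Rightarrow> int \<Rightarrow> nat" where
  "nested_sum p w L 0 t = 1"
| "nested_sum p w L (Suc k) t =
     (\<Sum>q = run_len p (int (Suc k))..run_sigma w (occ_head p w L (Suc k)) t.
        ((q - 1) choose (run_len p (int (Suc k)) - 1)) *
        nested_sum p w L k (t - 2 * int (left_span w t q) - 1))"

end

theory Submission imports Defs begin

text \<open>
  Let \<open>u\<^sub>t\<close> be the concatenation of the first \<open>t\<close> runs of \<open>w\<close>, and let \<open>P\<^sub>k\<close> be that of the first
  \<open>k\<close> runs of \<open>p\<close>. An occurrence of \<open>P\<^sub>k\<close> in \<open>u\<^sub>t\<close> is given by the position \<open>x\<close> of the first letter of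
  its \<open>k\<close>-th run, the remaining letters of that run, and an occurrence of \<open>P\<^bsub>k-1\<^esub>\<close> to the left
  of \<open>x\<close>. If \<open>x\<close> is the \<open>q\<close>-th suitable letter from the right, there are \<open>q - 1\<close> choose \<open>|A\<^sub>k| - 1\<close>
  possibilities for the second part; the occurrences of \<open>P\<^bsub>k-1\<^esub>\<close>, which end with the other letter,
  lie in the runs strictly before the run of \<open>x\<close>, whose index is read off from the left-span
  of \<open>q\<close>. Positions \<open>x\<close> before the \<open>k\<close>-th head contribute nothing: an occurrence of \<open>P\<^bsub>k-1\<^esub>\<close> to
  the left of \<open>x\<close>, then \<open>x\<close>, then the rest of \<open>L\<close> would contradict the minimality of \<open>L\<close>.
\<close>

section \<open>Counting occurrences\<close>

lemma finite_occurrences: "finite (occurrences p w)"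
proof (rule finite_subset)
  show "occurrences p w \<subseteq> {I. set I \<subseteq> {..<length w} \<and> length I = length p}"
    by (auto simp: occurrences_def)
qed (simp add: finite_lists_length_eq)

lemma occ_count_Nil [simp]: "occ_count [] w = 1"
proof -
  have "occurrences [] w = {[]}"
    by (auto simp: occurrences_def)
  then show ?thesis
    by (simp add: occ_count_def)
qed

lemma occ_count_snoc_Nil [simp]: "occ_count (p @ [b]) [] = 0"
proof -
  have "occurrences (p @ [b]) [] = {}"
    by (auto simp: occurrences_def)
  then show ?thesis
    by (simp add: occ_count_def)
qed

lemma occurrences_snoc_cases:
  assumes "I \<in> occurrences (p @ [b]) u"
  obtains J x where "I = J @ [x]" "x < length u" "u ! x = b" "\<forall>i\<in>set J. i < x"
    "sorted_wrt (<) J" "map ((!) u) J = p"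
proof (cases I rule: rev_cases)
  case (snoc J x)
  with assms that show thesis
    by (auto simp: occurrences_def sorted_wrt_append)
qed (use assms in \<open>auto simp: occurrences_def\<close>)

text \<open>Indices increase, so the new position \<open>length u\<close> can only be the last index
  of an occurrence; split according to whether it is.\<close>

lemma occurrences_snoc_snoc:
  "occurrences (p @ [b]) (u @ [a]) =
     occurrences (p @ [b]) u \<union> (if a = b then (\<lambda>I. I @ [length u]) ` occurrences p u else {})"
  (is "?l = ?r")
proof (intro equalityI subsetI)
  fix I assume "I \<in> ?l"
  then obtain J x where J: "I = J @ [x]" "x < length (u @ [a])" "(u @ [a]) ! x = b"
    "\<forall>i\<in>set J. i < x" "sorted_wrt (<) J" "map ((!) (u @ [a])) J = p"
    by (rule occurrences_snoc_cases)
  from J(2,4) have "map ((!) (u @ [a])) J = map ((!) u) J"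
    by (auto simp: nth_append)
  with J show "I \<in> ?r"
    by (cases "x = length u")
      (force simp: occurrences_def sorted_wrt_append nth_append)+
next
  fix I assume "I \<in> ?r"
  then consider "I \<in> occurrences (p @ [b]) u"
    | J where "a = b" "I = J @ [length u]" "J \<in> occurrences p u"
    by (auto split: if_splits)
  then show "I \<in> ?l"
  proof cases
    case 1
    then have "set I \<subseteq> {..<length u}"
      by (simp add: occurrences_def)
    then have "map ((!) (u @ [a])) I = map ((!) u) I"
      by (auto simp: nth_append)
    also have "\<dots> = p @ [b]"
      using 1 by (simp add: occurrences_def)
    finally show ?thesis
      using 1 by (auto simp: occurrences_def)
  next
    case 2
    then have "map ((!) (u @ [a])) J = map ((!) u) J"
      by (auto simp: occurrences_def nth_append)
    with 2 show ?thesis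
      by (auto simp: occurrences_def sorted_wrt_append)
  qed
qed

lemma occ_count_snoc_snoc:
  "occ_count (p @ [b]) (u @ [a]) =
     occ_count (p @ [b]) u + (if a = b then occ_count p u else 0)"
proof (cases "a = b")
  case True
  have "length u \<notin> set I" if "I \<in> occurrences (p @ [b]) u" for I
    using that by (auto simp: occurrences_def)
  then have "occurrences (p @ [b]) u \<inter> (\<lambda>I. I @ [length u]) ` occurrences p u = {}"
    by fastforce
  moreover have "card ((\<lambda>I. I @ [length u]) ` occurrences p u) = card (occurrences p u)"
    by (intro card_image) (auto simp: inj_on_def)
  ultimately show ?thesis
    using True
    by (simp add: occ_count_def occurrences_snoc_snoc card_Un_disjoint finite_occurrences)
qed (simp add: occ_count_def occurrences_snoc_snoc)

text \<open>The last index of an occurrence carries \<open>last p\<close>, so it lies in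
  \<open>u\<close>, and the others precede it.\<close>

lemma occ_count_append_irrelevant:
  assumes "p = [] \<or> last p \<notin> set v"
  shows "occ_count p (u @ v) = occ_count p u"
proof (cases p rule: rev_cases)
  case (snoc p' b)
  with assms have "b \<notin> set v"
    by simp
  then show ?thesis
    unfolding snoc
  proof (induction v rule: rev_induct)
    case (snoc a v)
    then show ?case
      using occ_count_snoc_snoc[of p' b "u @ v" a] by auto
  qed simp
qed simp

text \<open>
  The sum is over the possible first letters of a final block of \<open>n + 1\<close> letters \<open>b\<close>, as if \<open>u\<close>
  were followed by \<open>c\<close> more letters \<open>b\<close> that cannot be first.
\<close>

definition block_count :: "'a \<Rightarrow> nat \<Rightarrow> 'a list \<Rightarrow> nat \<Rightarrow> 'a list \<Rightarrow> nat" where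
  "block_count b n P c u =
     (\<Sum>x<length u. if u ! x = b
        then (c + count_list (drop (Suc x) u) b choose n) * occ_count P (take x u) else 0)"

lemma block_count_Nil [simp]: "block_count b n P c [] = 0"
  by (simp add: block_count_def)

text \<open>A final \<open>b\<close> follows every earlier candidate, which raises \<open>c\<close>
  by one, and is itself a candidate with only the \<open>c\<close> extra letters behind it.\<close>

lemma block_count_snoc:
  "block_count b n P c (u @ [a]) =
     (if a = b then block_count b n P (Suc c) u + (c choose n) * occ_count P u
      else block_count b n P c u)"
  by (auto simp: block_count_def nth_append intro!: sum.cong)

text \<open>Pascal's rule in every summand.\<close>

lemma block_count_Suc:
  "block_count b (Suc n) P (Suc c) u = block_count b (Suc n) P c u + block_count b n P c u"
  by (auto simp: block_count_def sum.distrib[symmetric] algebra_simps intro!: sum.cong)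

lemma block_count_0_Suc: "block_count b 0 P (Suc c) u = block_count b 0 P c u"
  by (auto simp: block_count_def intro!: sum.cong)

text \<open>Both sides obey the same recursion in the last letter of \<open>u\<close>;
  \<open>n\<close> varies because that recursion leads from \<open>n\<close> to
  \<open>n - 1\<close>.\<close>

lemma occ_count_append_replicate:
  "occ_count (P @ replicate (Suc n) b) u = block_count b n P 0 u"
proof (induction u arbitrary: n rule: rev_induct)
  case Nil
  have "P @ replicate (Suc n) b = (P @ replicate n b) @ [b]"
    by (simp add: replicate_append_same)
  then show ?case
    by (simp only: occ_count_snoc_Nil block_count_Nil)
next
  case (snoc a u)
  have eq: "P @ replicate (Suc n) b = (P @ replicate n b) @ [b]" for n
    by (simp add: replicate_append_same)
  have "occ_count (P @ replicate (Suc n) b) (u @ [a]) =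
      occ_count (P @ replicate (Suc n) b) u + (if a = b then occ_count (P @ replicate n b) u else 0)"
    unfolding eq by (rule occ_count_snoc_snoc)
  \<comment> \<open>For \<open>n = 0\<close> a new \<open>b\<close> opens the block, which gives the
    summand \<open>occ_count P u\<close>; otherwise \<open>0 choose n\<close> vanishes and Pascal's
    rule supplies the case \<open>n - 1\<close>.\<close>
  also have "\<dots> = block_count b n P 0 (u @ [a])"
    using snoc.IH[of n] snoc.IH[of "n - 1"]
    by (cases n) (auto simp: block_count_snoc block_count_Suc block_count_0_Suc)
  finally show ?case .
qed

lemma block_count_append_irrelevant:
  "b \<notin> set v \<Longrightarrow> block_count b n P c (u @ v) = block_count b n P c u"
proof (induction v rule: rev_induct)
  case (snoc a v)
  then show ?case
    using block_count_snoc[of b n P c "u @ v" a] by auto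
qed simp

text \<open>Behind the \<open>q\<close>-th appended letter from the right there are
  \<open>c + q - 1\<close> letters \<open>b\<close>; in front of it, \<open>P\<close> must fit into
  \<open>u\<close>, since it does not end in \<open>b\<close>. The induction turns the last letter
  into one of the extra ones.\<close>

lemma block_count_append_replicate:
  assumes "P = [] \<or> last P \<noteq> b"
  shows "block_count b n P c (u @ replicate l b) =
    block_count b n P (c + l) u + (\<Sum>q = 1..l. (c + q - 1 choose n) * occ_count P u)"
proof (induction l arbitrary: c)
  case (Suc l)
  have eq: "u @ replicate (Suc l) b = (u @ replicate l b) @ [b]"
    by (simp add: replicate_append_same)
  have occ: "occ_count P (u @ replicate l b) = occ_count P u"
    using assms by (intro occ_count_append_irrelevant) auto
  have "(\<Sum>q = 1..Suc l. (c + q - 1 choose n) * occ_count P u) =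
      (c choose n) * occ_count P u + (\<Sum>q = 1..l. (Suc c + q - 1 choose n) * occ_count P u)"
    by (subst sum.atLeast_Suc_atMost) (simp_all only: sum.shift_bounds_cl_Suc_ivl One_nat_def, simp_all)
  then show ?case
    unfolding eq block_count_snoc occ using Suc[of "Suc c"] by simp
qed simp

lemma block_count_eq_0:
  assumes "\<And>x. x < length u \<Longrightarrow> u ! x = b \<Longrightarrow> occ_count P (take x u) = 0"
  shows "block_count b n P c u = 0"
  using assms by (auto simp: block_count_def)

section \<open>Runs\<close>

text \<open>Since \<open>nat\<close> truncates, the prefix is empty for \<open>t \<le> 0\<close>; a
  descent in steps of two may end at \<open>t = 0\<close> or \<open>t = -1\<close>.\<close>

definition run_prefix :: "'a list \<Rightarrow> int \<Rightarrow> 'a list" where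
  "run_prefix w t = concat (take (nat t) (runs w))"

lemma run_prefix_all [simp]: "run_prefix w (int (num_runs w)) = w"
  by (simp add: run_prefix_def num_runs_def concat_runs)

lemma run_prefix_step:
  assumes "1 \<le> t" "t \<le> int (num_runs w)"
  shows "run_prefix w t = run_prefix w (t - 1) @ runs w ! nat (t - 1)"
proof -
  have "nat t = Suc (nat (t - 1))" "nat (t - 1) < length (runs w)"
    using assms by (auto simp: num_runs_def)
  then show ?thesis
    by (simp add: run_prefix_def take_Suc_conv_app_nth)
qed

lemma run_prefix_eq_take: "run_prefix w t = take (length (run_prefix w t)) w"
proof -
  have "w = run_prefix w t @ concat (drop (nat t) (runs w))"
    unfolding run_prefix_def concat_append[symmetric] append_take_drop_id concat_runs ..
  then show ?thesis
    by (metis append_eq_conv_conj)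
qed

lemma length_run_prefix_mono:
  assumes "t \<le> t'"
  shows "length (run_prefix w t) \<le> length (run_prefix w t')"
proof -
  have "take (nat t') (runs w) = take (nat t) (runs w) @ take (nat t' - nat t) (drop (nat t) (runs w))"
    using assms by (metis le_add_diff_inverse nat_mono take_add)
  then show ?thesis
    by (simp add: run_prefix_def)
qed

lemma run_eq_replicate:
  assumes "i < length (runs w)"
  shows "runs w ! i = replicate (length (runs w ! i)) (hd (runs w ! i))"
  using runs_constant[OF nth_mem[OF assms]]
  by (metis replicate_length_same singletonD)

lemma hd_run_parity:
  fixes w :: "bool list"
  assumes "i < length (runs w)"
  shows "hd (runs w ! i) \<longleftrightarrow> (hd (runs w ! 0) \<longleftrightarrow> even i)"
  using assms
proof (induction i)
  case (Suc i)
  then show ?case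
    using runs_maximal[of i w] by auto
qed simp

lemma hd_run_eq_iff:
  fixes w :: "bool list"
  assumes "1 \<le> i" "i \<le> int (num_runs w)" "1 \<le> j" "j \<le> int (num_runs w)"
  shows "hd (runs w ! nat (i - 1)) = hd (runs w ! nat (j - 1)) \<longleftrightarrow> even (i - j)"
proof -
  have "even (nat (i - 1)) \<longleftrightarrow> even (i - 1)" "even (nat (j - 1)) \<longleftrightarrow> even (j - 1)"
    using assms by (simp_all add: even_nat_iff)
  moreover have "nat (i - 1) < length (runs w)" "nat (j - 1) < length (runs w)"
    using assms by (auto simp: num_runs_def)
  ultimately show ?thesis
    using hd_run_parity[of "nat (i - 1)" w] hd_run_parity[of "nat (j - 1)" w] by auto
qed

lemma run_sigma_empty: "j < i \<Longrightarrow> run_sigma w i j = 0"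
  by (simp add: run_sigma_def)

lemma run_sigma_step:
  assumes "i \<le> j" "even (j - i)"
  shows "run_sigma w i j = run_sigma w i (j - 2) + run_len w j"
proof -
  from assms obtain k where k: "j = i + 2 * k" "0 \<le> k"
    by (metis add.commute diff_add_cancel diff_ge_0_iff_ge dvdE mult_2 zero_le_mult_iff zero_le_numeral not_numeral_le_zero)
  have "{0..k} = insert k {0..k - 1}"
    using k by auto
  moreover have "(j - 2 - i) div 2 = k - 1"
    using k by simp
  ultimately show ?thesis
    using k by (simp add: run_sigma_def)
qed

lemma left_span_eq_0: "q \<le> run_len w t \<Longrightarrow> left_span w t q = 0"
  using run_sigma_step[of t t w] by (simp add: left_span_def Least_eq_0)

text \<open>When \<open>q\<close> exceeds the length of run \<open>t\<close>, the span must go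
  beyond it; taking its letters off \<open>q\<close> leaves the same question at
  \<open>t - 2\<close>.\<close>

lemma left_span_step:
  assumes "run_len w t < q" "q \<le> run_sigma w h t" "even (t - h)" "h \<le> t"
  shows "left_span w t q = Suc (left_span w (t - 2) (q - run_len w t))"
proof -
  let ?Q = "\<lambda>k. q \<le> run_sigma w (t - 2 * int k) t"
  \<comment> \<open>For this argument the span starts at run \<open>h\<close>, so the assumed bound
    on \<open>q\<close> makes it a witness and the least \<open>k\<close> exists.\<close>
  have "?Q (nat ((t - h) div 2))"
    using assms by simp
  moreover have "\<not> ?Q 0"
    using assms run_sigma_step[of t t w] by (simp add: run_sigma_empty)
  ultimately have "(LEAST k. ?Q k) = Suc (LEAST k. ?Q (Suc k))"
    by (rule Least_Suc)
  moreover have "?Q (Suc k) \<longleftrightarrow> q - run_len w t \<le> run_sigma w (t - 2 - 2 * int k) (t - 2)" for k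
    using run_sigma_step[of "t - 2 * int (Suc k)" t w] assms(1)
    by (auto simp: algebra_simps)
  ultimately show ?thesis
    by (simp add: left_span_def)
qed

section \<open>The sum over one run\<close>

text \<open>Descent from \<open>t\<close> to \<open>t - 2\<close>. Values of \<open>q\<close> up to
  the length of run \<open>t\<close> choose a first letter inside that run; larger ones pass to
  earlier runs, while \<open>c\<close> records the letters \<open>b\<close> already passed. Once
  \<open>t < h\<close>, the sum is empty and \<open>zero\<close> annihilates the block
  count.\<close>

lemma sum_eq_block_count:
  fixes w P :: "bool list" and g :: "int \<Rightarrow> nat"
  assumes h: "1 \<le> h" "h \<le> int (num_runs w)" "hd (runs w ! nat (h - 1)) = b"
    and P: "P = [] \<or> last P \<noteq> b"
    and zero: "\<And>x. x < length (run_prefix w (h - 1)) \<Longrightarrow> w ! x = b \<Longrightarrow> occ_count P (take x w) = 0"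
    and g: "\<And>t. h - 1 \<le> t \<Longrightarrow> t < int (num_runs w) \<Longrightarrow> odd (t - h) \<Longrightarrow> g t = occ_count P (run_prefix w t)"
    and t: "even (t - h)" "t \<le> int (num_runs w)"
  shows "(\<Sum>q = 1..run_sigma w h t. (c + q - 1 choose n) * g (t - 2 * int (left_span w t q) - 1)) =
    block_count b n P c (run_prefix w t)"
  using t
proof (induction "nat (t + 2 - h)" arbitrary: t c rule: less_induct)
  case less
  show ?case
  proof (cases "t < h")
    case True
    have "block_count b n P c (run_prefix w t) = 0"
    proof (rule block_count_eq_0)
      fix x assume x: "x < length (run_prefix w t)" "run_prefix w t ! x = b"
      from x have "run_prefix w t ! x = w ! x" "take x (run_prefix w t) = take x w"
        by (subst run_prefix_eq_take, simp)+
      moreover have "x < length (run_prefix w (h - 1))"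
        using x True length_run_prefix_mono[of t "h - 1" w] by simp
      ultimately show "occ_count P (take x (run_prefix w t)) = 0"
        using zero x by simp
    qed
    with True show ?thesis
      by (simp add: run_sigma_empty)
  next
    case False
    define l where "l = run_len w t"
    \<comment> \<open>Explicit \<open>c\<close> and \<open>t\<close> allow the shift
      \<open>f c t (q + l) = f (c + l) (t - 2) q\<close> for the larger values of
      \<open>q\<close>.\<close>
    define f where "f c t q = (c + q - 1 choose n) * g (t - 2 * int (left_span w t q) - 1)" for c t q
    have t: "1 \<le> t" "h \<le> t"
      using False h by auto
    have hd: "hd (runs w ! nat (i - 1)) = b \<longleftrightarrow> even (i - h)" if "1 \<le> i" "i \<le> t" for i
      using hd_run_eq_iff[of i w h] h that less.prems by simp
    have len: "nat (t - 1) < length (runs w)"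
      using t less.prems by (auto simp: num_runs_def)
    have B: "runs w ! nat (t - 1) = replicate l b"
      using run_eq_replicate[OF len] hd[of t] t less.prems by (simp add: l_def run_len_def)
    \<comment> \<open>Run \<open>t - 1\<close> consists of the other letter; for
      \<open>t = 1\<close> both prefixes are empty.\<close>
    have prefix: "block_count b n P c' (run_prefix w (t - 1)) =
        block_count b n P c' (run_prefix w (t - 2))" for c'
    proof (cases "t = 1")
      case False
      then have len': "nat (t - 1 - 1) < length (runs w)"
        using t less.prems by (auto simp: num_runs_def)
      have "b \<notin> set (runs w ! nat (t - 1 - 1))"
        using runs_constant[OF nth_mem[OF len']] hd[of "t - 1"] False t less.prems by auto
      moreover have "run_prefix w (t - 1) = run_prefix w (t - 2) @ runs w ! nat (t - 1 - 1)"
        using run_prefix_step[of "t - 1" w] False t less.prems by simp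
      ultimately show ?thesis
        by (simp add: block_count_append_irrelevant)
    qed (simp add: run_prefix_def)
    have "(\<Sum>q = 1..run_sigma w h t. f c t q) = (\<Sum>q = 1..l + run_sigma w h (t - 2). f c t q)"
      using run_sigma_step[of h t w] t less.prems by (simp add: l_def add.commute)
    also have "\<dots> = (\<Sum>q = 1..l. f c t q) + (\<Sum>q = Suc l..l + run_sigma w h (t - 2). f c t q)"
      using sum.ub_add_nat[of 1 l "f c t"] by simp
    also have "(\<Sum>q = Suc l..l + run_sigma w h (t - 2). f c t q) =
        (\<Sum>q = 1..run_sigma w h (t - 2). f c t (q + l))"
      using sum.shift_bounds_cl_nat_ivl[of "f c t" 1 l "run_sigma w h (t - 2)"]
      by (simp add: add.commute)
    also have "\<dots> = (\<Sum>q = 1..run_sigma w h (t - 2). f (c + l) (t - 2) q)"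
    proof (rule sum.cong)
      fix q assume q: "q \<in> {1..run_sigma w h (t - 2)}"
      then have "left_span w t (q + l) = Suc (left_span w (t - 2) q)"
        using left_span_step[of w t "q + l" h] run_sigma_step[of h t w] t less.prems
        by (simp add: l_def)
      then show "f c t (q + l) = f (c + l) (t - 2) q"
        by (simp add: f_def algebra_simps)
    qed simp
    also have "\<dots> = block_count b n P (c + l) (run_prefix w (t - 2))"
      unfolding f_def using t less.prems by (intro less.hyps) auto
    also have "(\<Sum>q = 1..l. f c t q) =
        (\<Sum>q = 1..l. (c + q - 1 choose n) * occ_count P (run_prefix w (t - 1)))"
    proof (rule sum.cong)
      fix q assume "q \<in> {1..l}"
      then show "f c t q = (c + q - 1 choose n) * occ_count P (run_prefix w (t - 1))"
        using t less.prems g[of "t - 1"] by (simp add: f_def l_def left_span_eq_0)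
    qed simp
    also have "\<dots> + block_count b n P (c + l) (run_prefix w (t - 2)) =
        block_count b n P c (run_prefix w t)"
      using run_prefix_step[of t w] t less.prems block_count_append_replicate[OF P] B prefix
      by simp
    finally show ?thesis
      by (simp add: f_def)
  qed
qed

section \<open>The lexicographically minimal occurrence\<close>

lemma occ_count_before_lexmin:
  assumes L: "lexmin_occurrence p w L" and j: "j < length p"
    and x: "x < L ! j" "w ! x = p ! j"
  shows "occ_count (take j p) (take x w) = 0"
proof (rule ccontr)
  assume "occ_count (take j p) (take x w) \<noteq> 0"
  then obtain I where "I \<in> occurrences (take j p) (take x w)"
    by (metis all_not_in_conv card.empty occ_count_def)
  then have I: "sorted_wrt (<) I" "set I \<subseteq> {..<length (take x w)}"
    "map ((!) (take x w)) I = take j p"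
    by (auto simp: occurrences_def)
  have L': "sorted_wrt (<) L" "set L \<subseteq> {..<length w}" "map ((!) w) L = p"
    using L by (auto simp: lexmin_occurrence_def occurrences_def)
  have lenL: "length L = length p"
    using L'(3) by auto
  have lenI: "length I = j"
    using arg_cong[OF I(3), of length] j by simp
  have "L ! j < length w"
    using L'(2) lenL j nth_mem[of j L] by (auto simp del: nth_mem)
  with x have xw: "x < length w"
    by simp
  have mapI: "map ((!) w) I = take j p"
    using I(2,3) by (metis (no_types, lifting) length_take lessThan_iff map_eq_conv min_less_iff_conj nth_take subsetD)
  have later: "L ! j < i" if "i \<in> set (drop (Suc j) L)" for i
  proof -
    from that obtain k where "i = L ! (Suc j + k)" "Suc j + k < length L"
      by (auto simp: in_set_conv_nth)
    then show ?thesis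
      using sorted_wrt_nth_less[OF L'(1), of j "Suc j + k"] by simp
  qed
  \<comment> \<open>\<open>I\<close> has length \<open>j\<close>, so \<open>x\<close> takes the
    place of \<open>L ! j\<close>, and the tail of \<open>L\<close> stays to the right of
    \<open>x\<close>.\<close>
  let ?J = "I @ x # drop (Suc j) L"
  have "map ((!) w) ?J = take j p @ p ! j # drop (Suc j) p"
    using mapI x L'(3) by (simp flip: drop_map)
  also have "\<dots> = p"
    using j by (simp add: id_take_nth_drop[symmetric])
  finally have "map ((!) w) ?J = p" .
  moreover have "sorted_wrt (<) ?J"
    using I(1,2) later x(1) L'(1)
    by (force simp: sorted_wrt_append sorted_wrt_drop)
  moreover have "set ?J \<subseteq> {..<length w}"
    using I(2) xw L'(2) by (auto dest: in_set_dropD)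
  ultimately have "?J \<in> occurrences p w"
    by (auto simp: occurrences_def)
  then have "L ! j \<le> ?J ! j"
    using L j by (auto simp: lexmin_occurrence_def)
  with x lenI show False
    by (simp add: nth_append)
qed

text \<open>By leastness the first \<open>h - 1\<close> runs end at or before position
  \<open>y\<close>, while the first \<open>h\<close> runs cover it; hence \<open>y\<close> lies in
  run \<open>h\<close>, which is constant.\<close>

lemma run_index_bounds:
  assumes "y < length w"
  defines "h \<equiv> int (run_index w y)"
  shows "1 \<le> h" "h \<le> int (num_runs w)"
    "length (run_prefix w (h - 1)) \<le> y" "hd (runs w ! nat (h - 1)) = w ! y"
proof -
  let ?Q = "\<lambda>i. y < length (concat (take i (runs w)))"
  have all: "?Q (num_runs w)"
    using assms by (simp add: num_runs_def concat_runs)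
  have Q: "?Q (run_index w y)"
    unfolding run_index_def by (rule LeastI[of ?Q, OF all])
  show le: "h \<le> int (num_runs w)"
    unfolding h_def run_index_def using Least_le[of ?Q, OF all] by simp
  show ge: "1 \<le> h"
    using Q by (cases "run_index w y") (auto simp: h_def)
  have "\<not> ?Q (run_index w y - 1)"
    using ge not_less_Least[of "run_index w y - 1" ?Q] by (simp add: h_def run_index_def)
  moreover have "nat (h - 1) = run_index w y - 1"
    by (simp add: h_def nat_diff_distrib)
  ultimately show lower: "length (run_prefix w (h - 1)) \<le> y"
    by (simp add: run_prefix_def)
  have len: "nat (h - 1) < length (runs w)"
    using ge le by (auto simp: num_runs_def)
  have upper: "y < length (run_prefix w h)"
    using Q by (simp add: run_prefix_def h_def)
  then have "w ! y = run_prefix w h ! y"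
    by (metis nth_take run_prefix_eq_take)
  also have "\<dots> = (runs w ! nat (h - 1)) ! (y - length (run_prefix w (h - 1)))"
    using run_prefix_step[OF ge le] lower by (simp add: nth_append)
  also have "\<dots> \<in> set (runs w ! nat (h - 1))"
    using run_prefix_step[OF ge le] lower upper by (intro nth_mem) simp
  finally show "hd (runs w ! nat (h - 1)) = w ! y"
    using runs_constant[OF nth_mem[OF len]] by auto
qed

text \<open>Collects what \<open>sum_eq_block_count\<close> demands of \<open>h\<close>. For the
  last fact, the runs before the head lie to the left of the first letter of the corresponding part
  of \<open>L\<close>, so \<open>occ_count_before_lexmin\<close> applies.\<close>

lemma occ_head_bounds:
  assumes L: "lexmin_occurrence p w L" and k: "k < num_runs p"
  defines "h \<equiv> occ_head p w L (Suc k)"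
  shows "1 \<le> h" "h \<le> int (num_runs w)" "hd (runs w ! nat (h - 1)) = hd (runs p ! k)"
    and "\<And>x. x < length (run_prefix w (h - 1)) \<Longrightarrow> w ! x = hd (runs p ! k) \<Longrightarrow>
      occ_count (concat (take k (runs p))) (take x w) = 0"
proof -
  define j where "j = length (concat (take k (runs p)))"
  have k': "k < length (runs p)"
    using k by (simp add: num_runs_def)
  have "p = concat (take k (runs p) @ runs p ! k # drop (Suc k) (runs p))"
    using id_take_nth_drop[OF k'] by (metis concat_runs)
  then have split: "p = concat (take k (runs p)) @ runs p ! k @ concat (drop (Suc k) (runs p))"
    by simp
  have ne: "runs p ! k \<noteq> []"
    using runs_constant[OF nth_mem[OF k']] by blast
  have take: "take j p = concat (take k (runs p))"
    unfolding j_def using split by (metis append_eq_conv_conj)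
  have jp: "j < length p"
    using arg_cong[OF split, of length] ne by (simp add: j_def)
  have pj: "p ! j = hd (runs p ! k)"
    unfolding j_def using split ne
    by (metis append_is_Nil_conv hd_append2 hd_conv_nth nth_append_length_plus add_0_right)
  have occ: "set L \<subseteq> {..<length w}" "map ((!) w) L = p"
    using L by (auto simp: lexmin_occurrence_def occurrences_def)
  then have "length L = length p"
    by auto
  with occ jp have y: "L ! j < length w" "w ! (L ! j) = p ! j"
    by (metis lessThan_iff nth_mem subsetD) (metis occ(2) \<open>length L = length p\<close> jp nth_map)
  have h: "h = int (run_index w (L ! j))"
    by (simp add: h_def occ_head_def j_def)
  show "1 \<le> h" "h \<le> int (num_runs w)" "hd (runs w ! nat (h - 1)) = hd (runs p ! k)"
    using run_index_bounds[OF y(1)] y(2) pj by (simp_all add: h)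
  fix x assume "x < length (run_prefix w (h - 1))" "w ! x = hd (runs p ! k)"
  then show "occ_count (concat (take k (runs p))) (take x w) = 0"
    using occ_count_before_lexmin[OF L jp, of x] run_index_bounds(3)[OF y(1)]
    by (simp add: h take pj)
qed

section \<open>Assembling the nested sum\<close>

lemma last_concat_take_runs:
  fixes p :: "bool list"
  assumes "k < length (runs p)"
  shows "last (concat (take (Suc k) (runs p))) = hd (runs p ! k)"
proof -
  have "runs p ! k \<noteq> []"
    using runs_constant[OF nth_mem[OF assms]] by blast
  moreover have "last (runs p ! k) \<in> set (runs p ! k)"
    using calculation by simp
  ultimately show ?thesis
    using assms runs_constant[OF nth_mem[OF assms]] by (simp add: take_Suc_conv_app_nth)
qed

text \<open>Each induction step evaluates the outermost sum by \<open>sum_eq_block_count\<close>,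
  with the inner sums as \<open>g\<close>; \<open>t\<close> is arbitrary as it varies with
  \<open>q\<close>. The parity condition makes run \<open>t\<close>, if it exists, carry the letter
  of run \<open>k\<close> of \<open>p\<close>.\<close>

lemma nested_sum_eq_occ_count:
  fixes p w :: "bool list"
  assumes L: "lexmin_occurrence p w L"
    and "k \<le> num_runs p" "t \<le> int (num_runs w)"
    and "k > 0 \<Longrightarrow> even (t - occ_head p w L k)"
  shows "nested_sum p w L k t = occ_count (concat (take k (runs p))) (run_prefix w t)"
  using assms(2-)
proof (induction k arbitrary: t)
  case (Suc k)
  define h where "h = occ_head p w L (Suc k)"
  define b where "b = hd (runs p ! k)"
  define P where "P = concat (take k (runs p))"
  define n where "n = length (runs p ! k) - 1"
  define g where "g = nested_sum p w L k"
  have k: "k < length (runs p)" "k < num_runs p"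
    using Suc.prems by (simp_all add: num_runs_def)
  note h = occ_head_bounds[OF L k(2), folded h_def b_def P_def]
  have "runs p ! k \<noteq> []"
    using runs_constant[OF nth_mem[OF k(1)]] by blast
  then have len: "length (runs p ! k) = Suc n"
    by (simp add: n_def)
  have P: "P = [] \<or> last P \<noteq> b"
  proof (cases k)
    case (Suc k')
    then show ?thesis
      using last_concat_take_runs[of k' p] runs_maximal[of k' p] k by (simp add: P_def b_def)
  qed (simp add: P_def)
  \<comment> \<open>Consecutive runs of \<open>p\<close> differ, so their heads have indices of
    opposite parity; an index at odd distance from \<open>h\<close> thus has the parity required for
    \<open>k\<close>.\<close>
  have g: "g t' = occ_count P (run_prefix w t')" if "t' < int (num_runs w)" "odd (t' - h)" for t'
    unfolding g_def P_def
  proof (rule Suc.IH)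
    assume "k > 0"
    then obtain k' where k': "k = Suc k'"
      using gr0_implies_Suc by blast
    then have k'p: "k' < num_runs p"
      using k by simp
    note h' = occ_head_bounds[OF L k'p, folded k']
    have "hd (runs p ! k') \<noteq> hd (runs p ! k)"
      using runs_maximal[of k' p] k k' by simp
    then have "odd (occ_head p w L k - h)"
      using hd_run_eq_iff[OF h'(1,2) h(1,2)] h(3) h'(3) by (simp add: b_def)
    with that show "even (t' - occ_head p w L k)"
      by simp
  qed (use that Suc.prems in auto)
  have rl: "run_len p (int (Suc k)) = Suc n"
    using k len by (simp add: run_len_def nat_diff_distrib)
  have "nested_sum p w L (Suc k) t =
      (\<Sum>q = Suc n..run_sigma w h t. (q - 1 choose n) * g (t - 2 * int (left_span w t q) - 1))"
    unfolding nested_sum.simps rl h_def g_def by simp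
  \<comment> \<open>The added terms have \<open>q - 1 < n\<close> and vanish; the \<open>0 +\<close>
    matches \<open>c = 0\<close>.\<close>
  also have "\<dots> = (\<Sum>q = 1..run_sigma w h t. (0 + q - 1 choose n) * g (t - 2 * int (left_span w t q) - 1))"
    by (intro sum.mono_neutral_cong_left) (auto simp: binomial_eq_0)
  also have "\<dots> = block_count b n P 0 (run_prefix w t)"
    using Suc.prems by (intro sum_eq_block_count h P g) (simp_all add: h_def)
  also have "\<dots> = occ_count (P @ runs p ! k) (run_prefix w t)"
    using run_eq_replicate[OF k(1)] by (simp only: len b_def[symmetric] occ_count_append_replicate[symmetric])
  also have "P @ runs p ! k = concat (take (Suc k) (runs p))"
    using k by (simp add: P_def take_Suc_conv_app_nth)
  finally show ?case .
qed simp

theorem theorem1: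
  fixes p w :: "bool list" and L :: "nat list"
  assumes "lexmin_occurrence p w L"
  shows "occ_count p w = nested_sum p w L (num_runs p) (zeta p w)"
proof (cases "num_runs p")
  case 0
  then have "p = []"
    using concat_runs[of p] by (simp add: num_runs_def)
  with 0 show ?thesis
    by simp
next
  case (Suc k)
  then have k: "k < num_runs p" "k < length (runs p)"
    by (simp_all add: num_runs_def)
  define h where "h = occ_head p w L (Suc k)"
  define s where "s = int (num_runs w)"
  note h = occ_head_bounds[OF assms k(1), folded h_def]
  have lastp: "last (runs p) = runs p ! k"
    using Suc by (metis diff_Suc_1 last_conv_nth length_0_conv nat.distinct(1) num_runs_def)
  have s: "1 \<le> s" "s \<le> int (num_runs w)"
    using h by (simp_all add: s_def)
  then have lastw: "last (runs w) = runs w ! nat (s - 1)"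
    by (subst last_conv_nth) (auto simp: s_def num_runs_def nat_diff_distrib)
  \<comment> \<open>Hence \<open>zeta p w\<close> is the one of \<open>s\<close> and
    \<open>s - 1\<close> that has the parity of \<open>h\<close>.\<close>
  have same: "same_parity (last (runs p)) (last (runs w)) \<longleftrightarrow> even (s - h)"
    using hd_run_eq_iff[OF s h(1,2)] h(3) by (auto simp: same_parity_def lastp lastw)
  have p: "concat (take (num_runs p) (runs p)) = p"
    by (simp add: num_runs_def concat_runs)
  have "nested_sum p w L (num_runs p) (zeta p w) = occ_count p (run_prefix w (zeta p w))"
    unfolding p[symmetric, THEN arg_cong, of "\<lambda>x. occ_count x _"]
    using same by (intro nested_sum_eq_occ_count assms)
      (auto simp: zeta_def Suc simp flip: h_def s_def)
  also have "\<dots> = occ_count p w"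
  proof (cases "even (s - h)")
    case False
    \<comment> \<open>Here \<open>zeta p w = s - 1\<close>: the last run of \<open>w\<close> lacks
      the last letter of \<open>p\<close>, so removing it loses no occurrence.\<close>
    have "last p = hd (runs p ! k)"
      using last_concat_take_runs[OF k(2)] p by (simp add: Suc)
    moreover have "hd (runs p ! k) \<noteq> hd (runs w ! nat (s - 1))"
      using False same by (simp add: same_parity_def lastp lastw)
    moreover have "nat (s - 1) < length (runs w)"
      using s by (auto simp: num_runs_def)
    ultimately have "last p \<notin> set (runs w ! nat (s - 1))"
      using runs_constant[OF nth_mem, of "nat (s - 1)" w] by auto
    then have "occ_count p (run_prefix w s) = occ_count p (run_prefix w (s - 1))"
      unfolding run_prefix_step[OF s] by (intro occ_count_append_irrelevant) simp
    with False same show ?thesis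
      by (simp add: zeta_def s_def)
  qed (simp add: zeta_def same)
  finally show ?thesis
    by simp
qed

end
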